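(* Let $\lambda>0$. For any non-negative $\sigma\in L^1_{loc}[0,\infty)$ we have $$w[\sigma]\leq w[\bar{\sigma}]=\frac{\lambda\bar{\sigma}}{\lambda+\bar{\sigma}},$$ where $$\bar{\sigma}=\limsup_{\tau\to\infty}\frac{1}{\tau}\int_0^\tau\sigma(t)\,dt,\qquad w[\sigma]=\lambda\cdot\limsup_{\tau\to\infty}\frac{1}{\tau}\int_0^\tau x(t)\,dt,$$ and $x$, with values in $[0,1]$, is any solution on $[0,\infty)$ of $x'(t)=\sigma(t)(1-x(t))-\lambda x(t)$.
   Context: The equation $x'(t)=\sigma(t)(1-x(t))-\lambda x(t)$ models a system with a bottleneck entrance: $x\in[0,1]$ is the occupancy, $\sigma(t)\ge 0$ is the inflow rate, and $\lambda x$ is the output rate. Here $L^1_{loc}[0,\infty)$ denotes the measurable functions that are integrable on $[0,\tau]$ for every $\tau>0$, and solutions are locally absolutely continuous functions satisfying the equation for almost every $t$. The value $w[\sigma]$ does not depend on which solution $x$ is chosen. The notation $w[\bar\sigma]$ means $w$ evaluated at the constant inflow rate equal to $\bar\sigma$. *)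

theory Defs
  imports "HOL-Analysis.Analysis"
begin

definition abs_cont_on :: "real \<Rightarrow> real \<Rightarrow> (real \<Rightarrow> real) \<Rightarrow> bool" where
  "abs_cont_on a b f \<longleftrightarrow>
    (\<forall>\<epsilon>>0. \<exists>\<delta>>0. \<forall>(n::nat) (u::nat \<Rightarrow> real) (v::nat \<Rightarrow> real).
      (\<forall>i<n. a \<le> u i \<and> u i \<le> v i \<and> v i \<le> b) \<longrightarrow>
      (\<forall>i<n. \<forall>j<n. i \<noteq> j \<longrightarrow> {u i<..<v i} \<inter> {u j<..<v j} = {}) \<longrightarrow>
      (\<Sum>i<n. v i - u i) < \<delta> \<longrightarrow>
      (\<Sum>i<n. \<bar>f (v i) - f (u i)\<bar>) < \<epsilon>)"

(* Functions on [0, infinity) are total functions on the reals; every notion below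
   looks only at their values at t \<ge> 0. *)

definition locally_integrable :: "(real \<Rightarrow> real) \<Rightarrow> bool" where
  "locally_integrable f \<longleftrightarrow> (\<forall>\<tau>>0. set_integrable lebesgue {0..\<tau>} f)"

definition bottleneck_solution :: "real \<Rightarrow> (real \<Rightarrow> real) \<Rightarrow> (real \<Rightarrow> real) \<Rightarrow> bool" where
  "bottleneck_solution lam \<sigma> x \<longleftrightarrow>
    (\<forall>t\<ge>0. x t \<in> {0..1}) \<and>
    (\<forall>\<tau>>0. abs_cont_on 0 \<tau> x) \<and>
    (AE t in lebesgue. 0 \<le> t \<longrightarrow>
       (x has_real_derivative (\<sigma> t * (1 - x t) - lam * x t)) (at t within {0..}))"

(* Extended-real valued, since the upper mean of an inflow rate may be infinite. *)
definition upper_mean :: "(real \<Rightarrow> real) \<Rightarrow> ereal" where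
  "upper_mean f = Limsup at_top (\<lambda>\<tau>::real. ereal (1 / \<tau> * (LINT t:{0..\<tau>}|lebesgue. f t)))"

(* w[\<sigma>]. The value does not depend on which solution is selected. *)
definition mean_output :: "real \<Rightarrow> (real \<Rightarrow> real) \<Rightarrow> ereal" where
  "mean_output lam \<sigma> = ereal lam * upper_mean (SOME x. bottleneck_solution lam \<sigma> x)"

end

theory Submission
  imports Defs
begin

text \<open>Fix c in [0,1]. For a quadratic \<Phi> that is bounded on [0,1], the equation gives
  \<Phi>(x)' = (1 - c)^2 \<sigma> - \<lambda>(x - c^2) - (\<sigma> + \<lambda>)(x - c)^2 almost
  everywhere. Dropping the last term and integrating bounds the mean of \<lambda>x over [0,\<tau>]
  by (1 - c)^2 m + \<lambda>c^2 + 3/\<tau>, where m is the mean of \<sigma> there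
  (\<open>bottleneck_integral_bound\<close>). For c = s/(\<lambda> + s) the line (1 - c)^2 m +
  \<lambda>c^2 is the tangent at m = s to the concave function \<lambda>m/(\<lambda> + m). With s
  the upper mean of \<sigma> and \<tau> tending to infinity this is the claimed bound
  (\<open>upper_mean_bottleneck_le_steady_state\<close>); constant inflow s attains it at its
  equilibrium c.

  Since \<open>mean_output\<close> selects a solution by choice, all solutions must be shown to
  share one upper mean. The difference z of two solutions satisfies z' = -(\<sigma> + \<lambda>)z,
  so the integral of z^2 never exceeds 1/(2\<lambda>) and the mean of z tends to 0
  (\<open>bottleneck_solution_square_difference\<close>, \<open>upper_mean_bottleneck_le\<close>).

  The equation holds only almost everywhere, so both integrations rest on the fundamental theorem
  for absolutely continuous functions, \<open>abs_cont_on_has_integral\<close>, used as the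
  inequality \<open>abs_cont_on_increment_le\<close>.\<close>

section \<open>Absolute continuity via finite families of intervals\<close>

text \<open>Enumerating the index set reduces this to the definition. The free index type allows
  families indexed by the elements of a tagged division.\<close>

lemma abs_cont_on_finite_set:
  fixes a b \<epsilon> :: real and F :: "real \<Rightarrow> real"
  assumes "abs_cont_on a b F" "0 < \<epsilon>"
  shows "\<exists>\<delta>>0. \<forall>(I :: 'i set) u v. finite I \<longrightarrow>
        (\<forall>i\<in>I. a \<le> u i \<and> u i \<le> v i \<and> v i \<le> b) \<longrightarrow>
        disjoint_family_on (\<lambda>i. {u i<..<v i}) I \<longrightarrow> (\<Sum>i\<in>I. v i - u i) < \<delta> \<longrightarrow>
        (\<Sum>i\<in>I. \<bar>F (v i) - F (u i)\<bar>) < \<epsilon>"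
proof -
  obtain \<delta> where "\<delta> > 0" and \<delta>: "\<And>n (u::nat \<Rightarrow> real) v.
      \<lbrakk>\<forall>i<n. a \<le> u i \<and> u i \<le> v i \<and> v i \<le> b;
       \<forall>i<n. \<forall>j<n. i \<noteq> j \<longrightarrow> {u i<..<v i} \<inter> {u j<..<v j} = {};
       (\<Sum>i<n. v i - u i) < \<delta>\<rbrakk> \<Longrightarrow> (\<Sum>i<n. \<bar>F (v i) - F (u i)\<bar>) < \<epsilon>"
    using assms unfolding abs_cont_on_def by blast
  show ?thesis
  proof (intro exI[of _ \<delta>] conjI allI impI)
    fix I :: "'i set" and u v
    assume fin: "finite I" and uv: "\<forall>i\<in>I. a \<le> u i \<and> u i \<le> v i \<and> v i \<le> b"
      and dis: "disjoint_family_on (\<lambda>i. {u i<..<v i}) I" and small: "(\<Sum>i\<in>I. v i - u i) < \<delta>"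
    obtain h where h: "bij_betw h {..<card I} I"
      using ex_bij_betw_nat_finite[OF fin] by (auto simp: atLeast0LessThan)
    have hI: "h i \<in> I" if "i < card I" for i
      using h that by (auto simp: bij_betw_def)
    have hne: "h i \<noteq> h j" if "i < card I" "j < card I" "i \<noteq> j" for i j
      using h that by (auto simp: bij_betw_def inj_on_def)
    have sums: "(\<Sum>i\<in>I. f i) = (\<Sum>i<card I. f (h i))" for f :: "'i \<Rightarrow> real"
      using sum.reindex_bij_betw[OF h, of f] by simp
    have "(\<Sum>i<card I. \<bar>F (v (h i)) - F (u (h i))\<bar>) < \<epsilon>"
    proof (rule \<delta>)
      show "\<forall>i<card I. a \<le> u (h i) \<and> u (h i) \<le> v (h i) \<and> v (h i) \<le> b"
        using uv hI by blast
      show "\<forall>i<card I. \<forall>j<card I. i \<noteq> j \<longrightarrow>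
          {u (h i)<..<v (h i)} \<inter> {u (h j)<..<v (h j)} = {}"
        using dis hI hne unfolding disjoint_family_on_def by blast
      show "(\<Sum>i<card I. v (h i) - u (h i)) < \<delta>"
        using small by (simp add: sums)
    qed
    then show "(\<Sum>i\<in>I. \<bar>F (v i) - F (u i)\<bar>) < \<epsilon>"
      by (simp add: sums)
  qed (fact \<open>\<delta> > 0\<close>)
qed

text \<open>Smallness of the increment sums of \<open>g\<close> and \<open>h\<close> passes to
  \<open>f\<close>. This serves \<Phi>(x), with both \<open>g\<close> and \<open>h\<close> equal to
  x, and the squared difference of two solutions.\<close>

lemma abs_cont_on_dominated:
  assumes g: "abs_cont_on a b g" and h: "abs_cont_on a b h" and "0 \<le> L"
    and dom: "\<And>u v. \<lbrakk>a \<le> u; u \<le> v; v \<le> b\<rbrakk>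
      \<Longrightarrow> \<bar>f v - f u\<bar> \<le> L * (\<bar>g v - g u\<bar> + \<bar>h v - h u\<bar>)"
  shows "abs_cont_on a b f"
  unfolding abs_cont_on_def
proof (intro allI impI)
  fix e :: real assume "e > 0"
  \<comment> \<open>The \<open>+ 1\<close> covers \<open>L = 0\<close> and makes the final bound
    \<open>L * (2 * e') < e\<close> strict.\<close>
  define e' where "e' = e / (2 * (L + 1))"
  have "e' > 0" using \<open>e > 0\<close> \<open>0 \<le> L\<close> by (simp add: e'_def)
  obtain d1 where "d1 > 0" and d1: "\<forall>(I :: nat set) u v. finite I \<longrightarrow>
        (\<forall>i\<in>I. a \<le> u i \<and> u i \<le> v i \<and> v i \<le> b) \<longrightarrow>
        disjoint_family_on (\<lambda>i. {u i<..<v i}) I \<longrightarrow> (\<Sum>i\<in>I. v i - u i) < d1 \<longrightarrow>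
        (\<Sum>i\<in>I. \<bar>g (v i) - g (u i)\<bar>) < e'"
    using abs_cont_on_finite_set[OF g \<open>e' > 0\<close>] by blast
  obtain d2 where "d2 > 0" and d2: "\<forall>(I :: nat set) u v. finite I \<longrightarrow>
        (\<forall>i\<in>I. a \<le> u i \<and> u i \<le> v i \<and> v i \<le> b) \<longrightarrow>
        disjoint_family_on (\<lambda>i. {u i<..<v i}) I \<longrightarrow> (\<Sum>i\<in>I. v i - u i) < d2 \<longrightarrow>
        (\<Sum>i\<in>I. \<bar>h (v i) - h (u i)\<bar>) < e'"
    using abs_cont_on_finite_set[OF h \<open>e' > 0\<close>] by blast
  show "\<exists>\<delta>>0. \<forall>(n::nat) (u::nat \<Rightarrow> real) v.
      (\<forall>i<n. a \<le> u i \<and> u i \<le> v i \<and> v i \<le> b) \<longrightarrow>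
      (\<forall>i<n. \<forall>j<n. i \<noteq> j \<longrightarrow> {u i<..<v i} \<inter> {u j<..<v j} = {}) \<longrightarrow>
      (\<Sum>i<n. v i - u i) < \<delta> \<longrightarrow> (\<Sum>i<n. \<bar>f (v i) - f (u i)\<bar>) < e"
  proof (intro exI[of _ "min d1 d2"] conjI allI impI)
    show "0 < min d1 d2" using \<open>d1 > 0\<close> \<open>d2 > 0\<close> by simp
    fix n :: nat and u v :: "nat \<Rightarrow> real"
    assume uv: "\<forall>i<n. a \<le> u i \<and> u i \<le> v i \<and> v i \<le> b"
      and dis: "\<forall>i<n. \<forall>j<n. i \<noteq> j \<longrightarrow> {u i<..<v i} \<inter> {u j<..<v j} = {}"
      and small: "(\<Sum>i<n. v i - u i) < min d1 d2"
    let ?G = "\<Sum>i<n. \<bar>g (v i) - g (u i)\<bar>" and ?H = "\<Sum>i<n. \<bar>h (v i) - h (u i)\<bar>"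
    have "(\<Sum>i<n. \<bar>f (v i) - f (u i)\<bar>) \<le> (\<Sum>i<n. L * (\<bar>g (v i) - g (u i)\<bar> + \<bar>h (v i) - h (u i)\<bar>))"
      using uv by (intro sum_mono dom) auto
    also have "\<dots> = L * (?G + ?H)"
      by (simp add: sum_distrib_left sum.distrib algebra_simps)
    also have "\<dots> \<le> L * (2 * e')"
    proof -
      have "?G < e'" "?H < e'" 
        using d1[rule_format, of "{..<n}" u v] d2[rule_format, of "{..<n}" u v] uv dis small
        by (auto simp: disjoint_family_on_def)
      then show ?thesis using \<open>0 \<le> L\<close> by (intro mult_left_mono) auto
    qed
    also have "\<dots> < e"
      using \<open>e > 0\<close> \<open>0 \<le> L\<close> by (simp add: e'_def field_simps)
    finally show "(\<Sum>i<n. \<bar>f (v i) - f (u i)\<bar>) < e" .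
  qed
qed

lemma abs_cont_on_imp_continuous_on:
  assumes "abs_cont_on a b F"
  shows "continuous_on {a..b} F"
  unfolding continuous_on_iff
proof (intro ballI allI impI)
  fix s e :: real assume s: "s \<in> {a..b}" and "e > 0"
  \<comment> \<open>The one-element index type stands for a single interval, the one between s and
    t.\<close>
  obtain \<delta> where "\<delta> > 0" and \<delta>: "\<forall>(I :: unit set) u v. finite I \<longrightarrow>
        (\<forall>i\<in>I. a \<le> u i \<and> u i \<le> v i \<and> v i \<le> b) \<longrightarrow>
        disjoint_family_on (\<lambda>i. {u i<..<v i}) I \<longrightarrow> (\<Sum>i\<in>I. v i - u i) < \<delta> \<longrightarrow>
        (\<Sum>i\<in>I. \<bar>F (v i) - F (u i)\<bar>) < e"
    using abs_cont_on_finite_set[OF assms \<open>e > 0\<close>] by blast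
  have "dist (F t) (F s) < e" if "t \<in> {a..b}" "dist t s < \<delta>" for t
  proof -
    have "\<bar>F (max s t) - F (min s t)\<bar> < e"
      using \<delta>[rule_format, of "{()}" "\<lambda>_. min s t" "\<lambda>_. max s t"] that s
      by (auto simp: disjoint_family_on_def dist_real_def max_def min_def abs_if split: if_splits)
    then show ?thesis
      by (auto simp: dist_real_def max_def min_def abs_minus_commute split: if_splits)
  qed
  then show "\<exists>d>0. \<forall>t\<in>{a..b}. dist t s < d \<longrightarrow> dist (F t) (F s) < e"
    using \<open>\<delta> > 0\<close> by blast
qed

section \<open>The fundamental theorem for absolutely continuous functions\<close>

text \<open>Meant for the subintervals tagged in the exceptional null set: a small open set around
  them forces a small total length.\<close>

lemma sum_length_disjoint_intervals_le:
  fixes u v :: "'i \<Rightarrow> real"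
  assumes "finite I" "\<And>i. i \<in> I \<Longrightarrow> u i \<le> v i"
    and "disjoint_family_on (\<lambda>i. {u i<..<v i}) I"
    and "\<And>i. i \<in> I \<Longrightarrow> {u i<..<v i} \<subseteq> U" and U: "U \<in> lmeasurable"
  shows "(\<Sum>i\<in>I. v i - u i) \<le> measure lebesgue U"
proof -
  have "(\<Sum>i\<in>I. v i - u i) = (\<Sum>i\<in>I. measure lebesgue {u i<..<v i})"
    using assms(2) by (intro sum.cong) auto
  also have "\<dots> = measure lebesgue (\<Union>i\<in>I. {u i<..<v i})"
    using assms by (intro measure_finite_Union[symmetric]) (auto simp: less_top[symmetric])
  also have "\<dots> \<le> measure lebesgue U"
    using assms by (intro measure_mono_fmeasurable) auto
  finally show ?thesis .
qed

lemma null_set_outer_open: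
  fixes N :: "real set" and e :: real
  assumes "N \<in> null_sets lebesgue" "e > 0"
  obtains U where "open U" "N \<subseteq> U" "U \<in> lmeasurable" "measure lebesgue U < e"
proof -
  have "N \<in> sets lebesgue" using assms(1) by auto
  then obtain U where U: "open U" "N \<subseteq> U" "U - N \<in> lmeasurable" "emeasure lebesgue (U - N) < ennreal e"
    using sets_lebesgue_outer_open[OF _ \<open>e > 0\<close>] by metis
  have eq: "emeasure lebesgue (U - N) = emeasure lebesgue U"
    using U(1) assms(1) by (intro emeasure_Diff_null_set) auto
  have "U \<in> lmeasurable"
    using U eq by (intro fmeasurableI) (auto simp: fmeasurable_def)
  moreover have "measure lebesgue U < e"
    using U(4) \<open>e > 0\<close> eq \<open>U \<in> lmeasurable\<close> by (simp add: emeasure_eq_measure2 ennreal_less_iff)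
  ultimately show ?thesis using that U by blast
qed

text \<open>Henstock's form of the fundamental theorem: the gauge at a point of differentiability
  comes from the derivative; at the points of the exceptional null set it confines the
  subintervals to an open set so small that absolute continuity controls their increments.\<close>

theorem abs_cont_on_has_integral:
  fixes F f :: "real \<Rightarrow> real"
  assumes "a \<le> b" and ac: "abs_cont_on a b F"
    and ae: "AE t in lebesgue. t \<in> {a..b} \<longrightarrow> (F has_real_derivative f t) (at t within {a..b})"
  shows "(f has_integral (F b - F a)) {a..b}"
proof -
  obtain N where N: "{t. \<not> (t \<in> {a..b} \<longrightarrow> (F has_real_derivative f t) (at t within {a..b}))} \<subseteq> N"
      "N \<in> null_sets lebesgue"
    using ae unfolding eventually_ae_filter by auto
  \<comment> \<open>With value 0 on \<open>N\<close>, tags in \<open>N\<close> contribute nothing to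
    the Riemann sum, so only increments of \<open>F\<close> remain there; the change is undone at
    the end because \<open>N\<close> is negligible.\<close>
  define g where "g t = (if t \<in> N then 0 else f t)" for t
  have "(g has_integral (F b - F a)) {a..b}"
    unfolding has_integral_real
  proof (intro allI impI)
    fix e :: real assume "e > 0"
    obtain \<delta> where "\<delta> > 0" and \<delta>: "\<forall>(I :: (real \<times> real set) set) u v. finite I \<longrightarrow>
        (\<forall>i\<in>I. a \<le> u i \<and> u i \<le> v i \<and> v i \<le> b) \<longrightarrow>
        disjoint_family_on (\<lambda>i. {u i<..<v i}) I \<longrightarrow> (\<Sum>i\<in>I. v i - u i) < \<delta> \<longrightarrow>
        (\<Sum>i\<in>I. \<bar>F (v i) - F (u i)\<bar>) < e / 2"
    using abs_cont_on_finite_set[OF ac half_gt_zero[OF \<open>e > 0\<close>]] by blast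
    obtain U where U: "open U" "N \<subseteq> U" "U \<in> lmeasurable" "measure lebesgue U < \<delta>"
      using null_set_outer_open[OF N(2) \<open>\<delta> > 0\<close>] .
    \<comment> \<open>Chosen so that \<open>e1 * (b - a) \<le> e / 2\<close>; the \<open>+ 1\<close>
      covers \<open>a = b\<close>.\<close>
    define e1 where "e1 = e / (2 * (b - a + 1))"
    have "e1 > 0" using \<open>e > 0\<close> \<open>a \<le> b\<close> by (simp add: e1_def)
    have "\<exists>d>0. (t \<in> N \<longrightarrow> ball t d \<subseteq> U) \<and> (t \<in> {a..b} - N \<longrightarrow>
        (\<forall>y\<in>{a..b}. \<bar>y - t\<bar> < d \<longrightarrow> \<bar>F y - F t - (y - t) * f t\<bar> \<le> e1 * \<bar>y - t\<bar>))" for t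
    proof (cases "t \<in> N")
      case True
      then show ?thesis using U(1,2) open_contains_ball by blast
    next
      case False
      show ?thesis
      proof (cases "t \<in> {a..b}")
        case True
        then have "(F has_vector_derivative f t) (at t within {a..b})"
          using N(1) False by (auto simp: has_real_derivative_iff_has_vector_derivative)
        then show ?thesis
          using \<open>e1 > 0\<close> False
          unfolding has_vector_derivative_def has_derivative_within_alt by auto
      qed (use False in \<open>auto intro: exI[of _ 1]\<close>)
    qed
    then obtain d where dpos: "\<And>t. d t > 0" and dN: "\<And>t. t \<in> N \<Longrightarrow> ball t (d t) \<subseteq> U"
      and dd: "\<And>t y. \<lbrakk>t \<in> {a..b}; t \<notin> N; y \<in> {a..b}; \<bar>y - t\<bar> < d t\<rbrakk>
        \<Longrightarrow> \<bar>F y - F t - (y - t) * f t\<bar> \<le> e1 * \<bar>y - t\<bar>"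
      by (metis Diff_iff)
    show "\<exists>\<gamma>. gauge \<gamma> \<and> (\<forall>\<D>. \<D> tagged_division_of {a..b} \<and> \<gamma> fine \<D> \<longrightarrow>
        norm ((\<Sum>(x, k)\<in>\<D>. measure lborel k *\<^sub>R g x) - (F b - F a)) < e)"
    proof (intro exI[of _ "\<lambda>t. ball t (d t)"] conjI allI impI)
      show "gauge (\<lambda>t. ball t (d t))" using dpos gauge_ball_dependent by blast
      fix p assume "p tagged_division_of {a..b} \<and> (\<lambda>t. ball t (d t)) fine p"
      then have p: "p tagged_division_of {a..b}" and fine: "(\<lambda>t. ball t (d t)) fine p" by auto
      define u where "u q = Inf (snd q)" for q :: "real \<times> real set"
      define v where "v q = Sup (snd q)" for q :: "real \<times> real set"
      have q: "snd q = {u q..v q} \<and> u q \<le> fst q \<and> fst q \<le> v q \<and> a \<le> u q \<and> v q \<le> b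
          \<and> {u q..v q} \<subseteq> ball (fst q) (d (fst q))" if "q \<in> p" for q
      proof -
        have q': "(fst q, snd q) \<in> p" using that by simp
        obtain l r where lr: "snd q = {l..r}"
          using tagged_division_ofD(4)[OF p q'] by auto
        have "fst q \<in> {l..r}" "{l..r} \<subseteq> {a..b}" "{l..r} \<subseteq> ball (fst q) (d (fst q))"
          using tagged_division_ofD(2,3)[OF p q'] fine q' unfolding lr fine_def by auto
        then show ?thesis by (auto simp: u_def v_def lr)
      qed
      have finp: "finite p" using p by auto
      have dis: "disjoint_family_on (\<lambda>q. {u q<..<v q}) p"
        unfolding disjoint_family_on_def
      proof (intro ballI impI)
        fix q r assume qr: "q \<in> p" "r \<in> p" "q \<noteq> r"
        then have "interior (snd q) \<inter> interior (snd r) = {}"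
          using tagged_division_ofD(5)[OF p, of "fst q" "snd q" "fst r" "snd r"] by (auto simp: prod_eq_iff)
        then show "{u q<..<v q} \<inter> {u r<..<v r} = {}"
          using q[OF qr(1)] q[OF qr(2)] by simp
      qed
      have len: "b - a = (\<Sum>q\<in>p. v q - u q)" and incr: "F b - F a = (\<Sum>q\<in>p. F (v q) - F (u q))"
        using additive_tagged_division_1[OF \<open>a \<le> b\<close> p, of "\<lambda>x. x"]
          additive_tagged_division_1[OF \<open>a \<le> b\<close> p, of F]
        by (simp_all add: u_def v_def case_prod_beta)
      \<comment> \<open>The signed error on one subinterval. The increments of \<open>F\<close>
        telescope, so these errors add up to the Riemann sum minus \<open>F b - F a\<close>;
        \<open>I\<close> collects the tags in \<open>N\<close>.\<close>
      define D where "D q = (v q - u q) * g (fst q) - (F (v q) - F (u q))" for q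
      define I where "I = {q \<in> p. fst q \<in> N}"
      have "(\<Sum>(x, k)\<in>p. measure lborel k *\<^sub>R g x) = (\<Sum>q\<in>p. (v q - u q) * g (fst q))"
        unfolding case_prod_beta
      proof (intro sum.cong refl)
        fix r assume "r \<in> p"
        then show "measure lborel (snd r) *\<^sub>R g (fst r) = (v r - u r) * g (fst r)"
          using q[of r] by simp
      qed
      then have "(\<Sum>(x, k)\<in>p. measure lborel k *\<^sub>R g x) - (F b - F a) = sum D p"
        by (simp add: incr D_def sum_subtractf)
      also have "\<dots> = sum D I + sum D (p - I)"
        using finp by (subst add.commute, intro sum.subset_diff) (auto simp: I_def)
      finally have split: "(\<Sum>(x, k)\<in>p. measure lborel k *\<^sub>R g x) - (F b - F a) = sum D I + sum D (p - I)" .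
      have on_N: "\<bar>sum D I\<bar> < e / 2"
      proof -
        have "\<bar>sum D I\<bar> \<le> (\<Sum>q\<in>I. \<bar>F (v q) - F (u q)\<bar>)"
          by (rule order_trans[OF sum_abs]) (auto intro!: sum_mono simp: D_def I_def g_def)
        also have "\<dots> < e / 2"
        proof (rule \<delta>[rule_format])
          show "finite I" using finp by (simp add: I_def)
          show disI: "disjoint_family_on (\<lambda>q. {u q<..<v q}) I"
            using dis by (rule disjoint_family_on_mono[rotated]) (auto simp: I_def)
          show "a \<le> u r \<and> u r \<le> v r \<and> v r \<le> b" if "r \<in> I" for r
            using q[of r] that by (auto simp: I_def)
          have "(\<Sum>q\<in>I. v q - u q) \<le> measure lebesgue U"
          proof (rule sum_length_disjoint_intervals_le[OF \<open>finite I\<close> _ disI _ U(3)])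
            fix r assume r: "r \<in> I"
            then show "u r \<le> v r" using q[of r] by (auto simp: I_def)
            have "{u r..v r} \<subseteq> U" using r q[of r] dN[of "fst r"] by (auto simp: I_def)
            then show "{u r<..<v r} \<subseteq> U" by force
          qed
          then show "(\<Sum>q\<in>I. v q - u q) < \<delta>" using U(4) by simp
        qed
        finally show ?thesis .
      qed
      have off_N: "\<bar>sum D (p - I)\<bar> \<le> e / 2"
      proof -
        have "\<bar>D r\<bar> \<le> e1 * (v r - u r)" if "r \<in> p - I" for r
        proof -
          define t where "t = fst r"
          have r: "u r \<le> t" "t \<le> v r" "a \<le> u r" "v r \<le> b" "{u r..v r} \<subseteq> ball t (d t)" "t \<notin> N"
            using q[of r] that by (auto simp: I_def t_def)
          have "u r \<in> ball t (d t)" "v r \<in> ball t (d t)"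
            using r(1,2) by (auto intro!: subsetD[OF r(5)] simp del: mem_ball)
          then have near: "\<bar>u r - t\<bar> < d t" "\<bar>v r - t\<bar> < d t"
            by (auto simp: dist_real_def)
          \<comment> \<open>The tag separates the endpoints, so the derivative estimate is applied
            on each side of it, and the two error terms add up to \<open>e1\<close> times the
            length.\<close>
          have "\<bar>F (v r) - F t - (v r - t) * f t\<bar> \<le> e1 * \<bar>v r - t\<bar>"
            and "\<bar>F (u r) - F t - (u r - t) * f t\<bar> \<le> e1 * \<bar>u r - t\<bar>"
            by (intro dd near; use r in auto)+
          moreover have "D r = (F (u r) - F t - (u r - t) * f t) - (F (v r) - F t - (v r - t) * f t)"
            using r by (simp add: D_def g_def t_def[symmetric] algebra_simps)
          ultimately have "\<bar>D r\<bar> \<le> e1 * \<bar>u r - t\<bar> + e1 * \<bar>v r - t\<bar>" by linarith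
          also have "\<dots> = e1 * (v r - u r)" using r by (simp add: algebra_simps)
          finally show ?thesis .
        qed
        then have "\<bar>sum D (p - I)\<bar> \<le> (\<Sum>q\<in>p - I. e1 * (v q - u q))"
          by (intro order_trans[OF sum_abs] sum_mono) auto
        also have "\<dots> \<le> (\<Sum>q\<in>p. e1 * (v q - u q))"
        proof (rule sum_mono2[OF finp])
          fix r assume "r \<in> p - (p - I)"
          then show "0 \<le> e1 * (v r - u r)" using q[of r] \<open>e1 > 0\<close> by auto
        qed auto
        also have "\<dots> = e1 * (b - a)" by (simp add: len sum_distrib_left)
        also have "\<dots> \<le> e / 2"
          using \<open>e > 0\<close> \<open>a \<le> b\<close> by (simp add: e1_def field_simps)
        finally show ?thesis .
      qed
      show "norm ((\<Sum>(x, k)\<in>p. measure lborel k *\<^sub>R g x) - (F b - F a)) < e"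
        unfolding split using on_N off_N by simp
    qed
  qed
  moreover have "negligible N" using N(2) by (simp add: negligible_iff_null_sets)
  ultimately show ?thesis
    by (rule has_integral_spike[rotated 2]) (auto simp: g_def)
qed

text \<open>The form in which the differential equation gets integrated: a bound on the derivative
  outside a null set is enough.\<close>

lemma abs_cont_on_increment_le:
  fixes F f h :: "real \<Rightarrow> real"
  assumes "a \<le> b" and ac: "abs_cont_on a b F"
    and ae: "AE t in lebesgue. t \<in> {a..b} \<longrightarrow>
      (F has_real_derivative f t) (at t within {a..b}) \<and> f t \<le> h t"
    and h: "h integrable_on {a..b}"
  shows "F b - F a \<le> integral {a..b} h"
proof -
  obtain N where N: "{t. \<not> (t \<in> {a..b} \<longrightarrow>
        (F has_real_derivative f t) (at t within {a..b}) \<and> f t \<le> h t)} \<subseteq> N"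
      "N \<in> null_sets lebesgue"
    using ae unfolding eventually_ae_filter by auto
  have neg: "negligible N" using N(2) by (simp add: negligible_iff_null_sets)
  \<comment> \<open>Replacing f by h on the null set makes the comparison hold at every point, as
    \<open>has_integral_le\<close> asks.\<close>
  define f' where "f' t = (if t \<in> N then h t else f t)" for t
  have "(f has_integral (F b - F a)) {a..b}"
    using ae by (intro abs_cont_on_has_integral[OF \<open>a \<le> b\<close> ac]) auto
  then have "(f' has_integral (F b - F a)) {a..b}"
    by (rule has_integral_spike[OF neg, rotated]) (auto simp: f'_def)
  then show ?thesis
    by (rule has_integral_le[OF _ integrable_integral[OF h]]) (use N(1) in \<open>auto simp: f'_def\<close>)
qed

section \<open>Basic properties of solutions\<close>

context
  fixes lam :: real and \<sigma> x :: "real \<Rightarrow> real"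
  assumes sol: "bottleneck_solution lam \<sigma> x"
begin

lemma bottleneck_solution_range: "0 \<le> t \<Longrightarrow> 0 \<le> x t \<and> x t \<le> 1"
  using sol by (auto simp: bottleneck_solution_def)

lemma bottleneck_solution_abs_cont: "0 < \<tau> \<Longrightarrow> abs_cont_on 0 \<tau> x"
  using sol by (auto simp: bottleneck_solution_def)

lemma bottleneck_solution_deriv:
  "AE t in lebesgue. t \<in> {0..\<tau>} \<longrightarrow>
    (x has_real_derivative \<sigma> t * (1 - x t) - lam * x t) (at t within {0..\<tau>})"
proof -
  have "AE t in lebesgue. 0 \<le> t \<longrightarrow>
      (x has_real_derivative \<sigma> t * (1 - x t) - lam * x t) (at t within {0..})"
    using sol by (auto simp: bottleneck_solution_def)
  then show ?thesis
    by (rule AE_mp) (auto intro!: AE_I2 intro: DERIV_subset)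
qed

text \<open>Needed to exchange the Lebesgue integral in \<open>upper_mean\<close> for the gauge
  integral of the fundamental theorem.\<close>

lemma bottleneck_solution_integrable:
  assumes "0 < \<tau>"
  shows "set_integrable lebesgue {0..\<tau>} x"
proof -
  have "continuous_on {0..\<tau>} x"
    using bottleneck_solution_abs_cont[OF assms] by (rule abs_cont_on_imp_continuous_on)
  then have "x absolutely_integrable_on {0..\<tau>}"
    by (rule absolutely_integrable_continuous_real)
  then show ?thesis .
qed

end

section \<open>The integral inequality for an arbitrary level c\<close>

text \<open>With \<open>\<Phi>(x) = (1 - 2c)x + x\<^sup>2/2\<close>, the increment of \<open>\<Phi>\<close> along a solution is
  \<open>\<Phi>'(x)(1 - x)\<sigma> - \<lambda>x\<Phi>'(x)\<close>. Here \<open>\<Phi>'(x)(1 - x) = (1 - c)\<^sup>2 - (x - c)\<^sup>2\<close> and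
  \<open>x\<Phi>'(x) = x - c\<^sup>2 + (x - c)\<^sup>2\<close>, so both squares can be dropped.
  Applied with \<open>c = s/(\<lambda> + s)\<close>, the equilibrium for the constant inflow \<open>s\<close>, this gives the sharp bound.\<close>

lemma bottleneck_integral_bound:
  fixes lam c \<tau> :: real
  assumes lam: "0 < lam" and nn: "AE t in lebesgue. 0 \<le> t \<longrightarrow> 0 \<le> \<sigma> t"
    and int: "locally_integrable \<sigma>" and sol: "bottleneck_solution lam \<sigma> x"
    and c: "0 \<le> c" "c \<le> 1" and "0 < \<tau>"
  shows "lam * (LINT t:{0..\<tau>}|lebesgue. x t)
    \<le> (1 - c)\<^sup>2 * (LINT t:{0..\<tau>}|lebesgue. \<sigma> t) + lam * c\<^sup>2 * \<tau> + 3"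
proof -
  define \<Phi> where "\<Phi> y = (1 - 2 * c) * y + y\<^sup>2 / 2" for y :: real
  define h where "h t = (1 - c)\<^sup>2 * \<sigma> t - lam * (x t - c\<^sup>2)" for t
  note range = bottleneck_solution_range[OF sol]
  have "set_integrable lebesgue {0..\<tau>} \<sigma>"
    using int \<open>0 < \<tau>\<close> by (simp add: locally_integrable_def)
  note \<sigma> = set_lebesgue_integral_eq_integral[OF this]
  note x = set_lebesgue_integral_eq_integral[OF bottleneck_solution_integrable[OF sol \<open>0 < \<tau>\<close>]]
  have "abs_cont_on 0 \<tau> (\<lambda>t. \<Phi> (x t))"
  proof (rule abs_cont_on_dominated[where L = 1])
    show "abs_cont_on 0 \<tau> x" "abs_cont_on 0 \<tau> x"
      using bottleneck_solution_abs_cont[OF sol \<open>0 < \<tau>\<close>] by auto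
    fix u v assume "0 \<le> u" "u \<le> v" "v \<le> \<tau>"
    then have "0 \<le> x u" "x u \<le> 1" "0 \<le> x v" "x v \<le> 1" using range by auto
    \<comment> \<open>This factor is \<Phi>' at the midpoint of \<open>x u\<close> and
      \<open>x v\<close>; it lies between -1 and 2.\<close>
    then have "\<bar>1 - 2 * c + (x v + x u) / 2\<bar> \<le> 2" using c by (simp add: abs_le_iff field_simps)
    then have "\<bar>x v - x u\<bar> * \<bar>1 - 2 * c + (x v + x u) / 2\<bar> \<le> \<bar>x v - x u\<bar> * 2"
      by (intro mult_left_mono) auto
    moreover have "\<Phi> (x v) - \<Phi> (x u) = (x v - x u) * (1 - 2 * c + (x v + x u) / 2)"
      by (simp add: \<Phi>_def field_simps power2_eq_square)
    ultimately show "\<bar>\<Phi> (x v) - \<Phi> (x u)\<bar> \<le> 1 * (\<bar>x v - x u\<bar> + \<bar>x v - x u\<bar>)"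
      by (simp add: abs_mult)
  qed simp
  moreover have "AE t in lebesgue. t \<in> {0..\<tau>} \<longrightarrow>
      ((\<lambda>t. \<Phi> (x t)) has_real_derivative (1 - 2 * c + x t) * (\<sigma> t * (1 - x t) - lam * x t))
        (at t within {0..\<tau>}) \<and>
      (1 - 2 * c + x t) * (\<sigma> t * (1 - x t) - lam * x t) \<le> h t"
    using bottleneck_solution_deriv[OF sol, of \<tau>] nn
  proof eventually_elim
    case (elim t)
    show ?case
    proof
      assume t: "t \<in> {0..\<tau>}"
      note d = elim(1)[rule_format, OF t]
      have "((\<lambda>t. \<Phi> (x t)) has_real_derivative (1 - 2 * c + x t) * (\<sigma> t * (1 - x t) - lam * x t))
          (at t within {0..\<tau>})"
        unfolding \<Phi>_def by (rule derivative_eq_intros d refl | simp)+ (simp add: algebra_simps)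
      \<comment> \<open>Both discarded squares together; they are non-negative because \<sigma> and
        \<lambda> are.\<close>
      moreover have "h t - (1 - 2 * c + x t) * (\<sigma> t * (1 - x t) - lam * x t) = (\<sigma> t + lam) * (x t - c)\<^sup>2"
        unfolding h_def by (simp add: algebra_simps power2_eq_square)
      moreover have "0 \<le> (\<sigma> t + lam) * (x t - c)\<^sup>2"
        using elim(2) t lam by (intro mult_nonneg_nonneg) auto
      ultimately show "((\<lambda>t. \<Phi> (x t)) has_real_derivative (1 - 2 * c + x t) * (\<sigma> t * (1 - x t) - lam * x t))
          (at t within {0..\<tau>}) \<and> (1 - 2 * c + x t) * (\<sigma> t * (1 - x t) - lam * x t) \<le> h t"
        by linarith
    qed
  qed
  moreover have h: "(h has_integral ((1 - c)\<^sup>2 * integral {0..\<tau>} \<sigma> - lam * (integral {0..\<tau>} x - \<tau> * c\<^sup>2))) {0..\<tau>}"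
    unfolding h_def
    using has_integral_const_real[of "c\<^sup>2" 0 \<tau>] \<open>0 < \<tau>\<close> x(1) \<sigma>(1)
    by (intro has_integral_diff has_integral_mult_right integrable_integral) auto
  ultimately have "\<Phi> (x \<tau>) - \<Phi> (x 0) \<le> integral {0..\<tau>} h"
    using \<open>0 < \<tau>\<close> by (intro abs_cont_on_increment_le[where F = "\<lambda>t. \<Phi> (x t)"]) auto
  then have "\<Phi> (x \<tau>) - \<Phi> (x 0) \<le> (1 - c)\<^sup>2 * integral {0..\<tau>} \<sigma> - lam * (integral {0..\<tau>} x - \<tau> * c\<^sup>2)"
    using integral_unique[OF h] by simp
  \<comment> \<open>Linear part at most 1, quadratic part at most 1/2; two endpoints give the
    constant 3.\<close>
  moreover have "\<bar>\<Phi> y\<bar> \<le> 3 / 2" if "0 \<le> y" "y \<le> 1" for y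
  proof -
    have "\<bar>1 - 2 * c\<bar> * \<bar>y\<bar> \<le> 1 * 1" using that c by (intro mult_mono) auto
    moreover have "0 \<le> y\<^sup>2" "y\<^sup>2 \<le> 1" using that by (auto simp: power_le_one)
    ultimately show ?thesis unfolding \<Phi>_def abs_mult[symmetric] by linarith
  qed
  then have "\<bar>\<Phi> (x \<tau>)\<bar> \<le> 3 / 2" "\<bar>\<Phi> (x 0)\<bar> \<le> 3 / 2"
    using range[of \<tau>] range[of 0] \<open>0 < \<tau>\<close> by auto
  ultimately show ?thesis
    unfolding x(2) \<sigma>(2) by (simp add: algebra_simps)
qed

section \<open>Independence of the chosen solution\<close>

text \<open>The difference z decays by z' = -(\<sigma> + \<lambda>)z, hence (z^2)' \<le>
  -2\<lambda>z^2, while z^2 starts at most at 1. What matters is that the bound does not depend on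
  \<tau>.\<close>

lemma bottleneck_solution_square_difference:
  fixes lam \<tau> :: real
  assumes lam: "0 < lam" and nn: "AE t in lebesgue. 0 \<le> t \<longrightarrow> 0 \<le> \<sigma> t"
    and x: "bottleneck_solution lam \<sigma> x" and y: "bottleneck_solution lam \<sigma> y" and "0 < \<tau>"
  shows "(\<lambda>t. (x t - y t)\<^sup>2) integrable_on {0..\<tau>}"
    and "2 * lam * integral {0..\<tau>} (\<lambda>t. (x t - y t)\<^sup>2) \<le> 1"
proof -
  define z where "z t = x t - y t" for t
  note acx = bottleneck_solution_abs_cont[OF x \<open>0 < \<tau>\<close>]
    and acy = bottleneck_solution_abs_cont[OF y \<open>0 < \<tau>\<close>]
  have z1: "\<bar>z t\<bar> \<le> 1" if "0 \<le> t" for t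
    using bottleneck_solution_range[OF x that] bottleneck_solution_range[OF y that]
    by (auto simp: z_def)
  have ac: "abs_cont_on 0 \<tau> (\<lambda>t. (z t)\<^sup>2)"
  proof (rule abs_cont_on_dominated[OF acx acy, where L = 2])
    fix u v assume "0 \<le> u" "u \<le> v" "v \<le> \<tau>"
    then have "\<bar>z v + z u\<bar> \<le> 2" using z1[of u] z1[of v] by auto
    then have "\<bar>z v + z u\<bar> * \<bar>z v - z u\<bar> \<le> 2 * (\<bar>x v - x u\<bar> + \<bar>y v - y u\<bar>)"
      by (intro mult_mono) (auto simp: z_def)
    then show "\<bar>(z v)\<^sup>2 - (z u)\<^sup>2\<bar> \<le> 2 * (\<bar>x v - x u\<bar> + \<bar>y v - y u\<bar>)"
      by (simp add: abs_mult[symmetric] algebra_simps power2_eq_square)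
  qed simp
  then have int: "(\<lambda>t. (z t)\<^sup>2) integrable_on {0..\<tau>}"
    by (intro integrable_continuous_real abs_cont_on_imp_continuous_on)
  then show "(\<lambda>t. (x t - y t)\<^sup>2) integrable_on {0..\<tau>}" by (simp add: z_def)
  have "AE t in lebesgue. t \<in> {0..\<tau>} \<longrightarrow>
      ((\<lambda>t. (z t)\<^sup>2) has_real_derivative - 2 * (\<sigma> t + lam) * (z t)\<^sup>2) (at t within {0..\<tau>}) \<and>
      - 2 * (\<sigma> t + lam) * (z t)\<^sup>2 \<le> - (2 * lam) * (z t)\<^sup>2"
    using bottleneck_solution_deriv[OF x, of \<tau>] bottleneck_solution_deriv[OF y, of \<tau>] nn
  proof eventually_elim
    case (elim t)
    show ?case
    proof
      assume t: "t \<in> {0..\<tau>}"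
      note d = elim(1)[rule_format, OF t] elim(2)[rule_format, OF t]
      have "((\<lambda>t. (z t)\<^sup>2) has_real_derivative - 2 * (\<sigma> t + lam) * (z t)\<^sup>2) (at t within {0..\<tau>})"
        unfolding z_def
        by (rule derivative_eq_intros d refl | simp)+ (simp add: algebra_simps power2_eq_square)
      moreover have "0 \<le> \<sigma> t * (z t)\<^sup>2" using elim(3) t by simp
      ultimately show "((\<lambda>t. (z t)\<^sup>2) has_real_derivative - 2 * (\<sigma> t + lam) * (z t)\<^sup>2) (at t within {0..\<tau>}) \<and>
          - 2 * (\<sigma> t + lam) * (z t)\<^sup>2 \<le> - (2 * lam) * (z t)\<^sup>2"
        by (simp add: algebra_simps)
    qed
  qed
  then have "(z \<tau>)\<^sup>2 - (z 0)\<^sup>2 \<le> integral {0..\<tau>} (\<lambda>t. - (2 * lam) * (z t)\<^sup>2)"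
    using \<open>0 < \<tau>\<close> int by (intro abs_cont_on_increment_le[OF _ ac] integrable_on_mult_right) auto
  also have "\<dots> = - (2 * lam) * integral {0..\<tau>} (\<lambda>t. (z t)\<^sup>2)"
    by (rule integral_mult_right)
  finally have "2 * lam * integral {0..\<tau>} (\<lambda>t. (z t)\<^sup>2) \<le> (z 0)\<^sup>2 - (z \<tau>)\<^sup>2" by simp
  also have "\<dots> \<le> 1"
    using z1[of 0] zero_le_power2[of "z \<tau>"] abs_square_le_1[of "z 0"] by linarith
  finally show "2 * lam * integral {0..\<tau>} (\<lambda>t. (x t - y t)\<^sup>2) \<le> 1" by (simp add: z_def)
qed

text \<open>A bounded integral of the squared difference is negligible after division by \<tau>. One
  inequality suffices, since the two solutions can be exchanged.\<close>

lemma upper_mean_bottleneck_le: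
  assumes lam: "0 < lam" and nn: "AE t in lebesgue. 0 \<le> t \<longrightarrow> 0 \<le> \<sigma> t"
    and x: "bottleneck_solution lam \<sigma> x" and y: "bottleneck_solution lam \<sigma> y"
  shows "upper_mean x \<le> upper_mean y"
  unfolding upper_mean_def[of x] Limsup_le_iff
proof (intro allI impI)
  fix C assume "upper_mean y < C"
  then obtain r where r: "upper_mean y < ereal r" "ereal r < C" using ereal_dense2 by blast
  then obtain r' where r': "ereal r < ereal r'" "ereal r' < C" using ereal_dense2 by blast
  \<comment> \<open>Half of the gap \<open>r' - r\<close> pays for the constant in the pointwise
    estimate below, half for the square term.\<close>
  define e where "e = (r' - r) / 2"
  have "e > 0" and two_e: "2 * e = r' - r" using r' by (simp_all add: e_def)
  have "eventually (\<lambda>\<tau>::real. ereal (1 / \<tau> * (LINT t:{0..\<tau>}|lebesgue. y t)) < ereal r) at_top"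
    using r(1) by (auto simp: upper_mean_def dest!: Limsup_lessD)
  \<comment> \<open>Beyond the second threshold,
    \<open>(1 / (2 * lam)) / (4 * e) < \<tau> * e\<close>; the 1 ensures that \<tau> is
    positive.\<close>
  moreover have "eventually (\<lambda>\<tau>::real. \<tau> > max 1 (1 / (8 * lam * e\<^sup>2))) at_top"
    by (rule eventually_gt_at_top)
  ultimately show "eventually (\<lambda>\<tau>::real. ereal (1 / \<tau> * (LINT t:{0..\<tau>}|lebesgue. x t)) < C) at_top"
  proof eventually_elim
    case (elim \<tau>)
    then have \<tau>: "0 < \<tau>" "1 / (8 * lam * e\<^sup>2) < \<tau>" by auto
    note X = set_lebesgue_integral_eq_integral[OF bottleneck_solution_integrable[OF x \<tau>(1)]]
    note Y = set_lebesgue_integral_eq_integral[OF bottleneck_solution_integrable[OF y \<tau>(1)]]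
    note Z = bottleneck_solution_square_difference[OF lam nn x y \<tau>(1)]
    \<comment> \<open>Young's inequality z \<le> e + z^2/(4e), trading the difference for its
      square.\<close>
    have "x t \<le> y t + e + (x t - y t)\<^sup>2 / (4 * e)" for t
    proof -
      have "0 \<le> (2 * e - (x t - y t))\<^sup>2 / (4 * e)" using \<open>e > 0\<close> by simp
      also have "\<dots> = e + (x t - y t)\<^sup>2 / (4 * e) - (x t - y t)"
        using \<open>e > 0\<close> by (simp add: field_simps power2_eq_square)
      finally show ?thesis by simp
    qed
    moreover have "((\<lambda>t. y t + e + (x t - y t)\<^sup>2 / (4 * e)) has_integral
        (integral {0..\<tau>} y + \<tau> * e + integral {0..\<tau>} (\<lambda>t. (x t - y t)\<^sup>2) / (4 * e))) {0..\<tau>}"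
      using has_integral_const_real[of e 0 \<tau>] \<tau>(1) Y(1) Z(1)
      by (intro has_integral_add has_integral_divide integrable_integral) auto
    ultimately have "integral {0..\<tau>} x
        \<le> integral {0..\<tau>} y + \<tau> * e + integral {0..\<tau>} (\<lambda>t. (x t - y t)\<^sup>2) / (4 * e)"
      by (intro has_integral_le[OF integrable_integral[OF X(1)]]) auto
    also have "integral {0..\<tau>} (\<lambda>t. (x t - y t)\<^sup>2) / (4 * e) \<le> (1 / (2 * lam)) / (4 * e)"
      using Z(2) lam \<open>e > 0\<close> by (intro divide_right_mono) (auto simp: field_simps)
    also have "(1 / (2 * lam)) / (4 * e) < \<tau> * e"
      using \<tau>(2) lam \<open>e > 0\<close> by (simp add: field_simps power2_eq_square)
    finally have "integral {0..\<tau>} x < integral {0..\<tau>} y + 2 * \<tau> * e" by simp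
    then have "1 / \<tau> * integral {0..\<tau>} x < 1 / \<tau> * integral {0..\<tau>} y + 2 * e"
      using \<tau>(1) by (simp add: field_simps)
    moreover have "1 / \<tau> * integral {0..\<tau>} y < r" using elim(1) Y(2) by simp
    ultimately have "1 / \<tau> * integral {0..\<tau>} x < r'"
      using two_e by linarith
    then have "ereal (1 / \<tau> * (LINT t:{0..\<tau>}|lebesgue. x t)) < ereal r'" by (simp add: X(2))
    then show ?case using r'(2) by (rule less_trans)
  qed
qed

text \<open>The given solution shows that \<open>SOME\<close> yields a solution; comparing the two
  in both directions gives equal upper means.\<close>

lemma mean_output_eq:
  assumes "0 < lam" "AE t in lebesgue. 0 \<le> t \<longrightarrow> 0 \<le> \<sigma> t" and x: "bottleneck_solution lam \<sigma> x"
  shows "mean_output lam \<sigma> = ereal lam * upper_mean x"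
proof -
  have "bottleneck_solution lam \<sigma> (SOME x. bottleneck_solution lam \<sigma> x)"
    by (rule someI[of "bottleneck_solution lam \<sigma>", OF x])
  then have "upper_mean (SOME x. bottleneck_solution lam \<sigma> x) = upper_mean x"
    using assms by (intro antisym upper_mean_bottleneck_le) auto
  then show ?thesis by (simp add: mean_output_def)
qed

section \<open>Upper means and the steady state\<close>

lemma upper_mean_const: "upper_mean (\<lambda>_. c) = ereal c"
proof -
  have "eventually (\<lambda>\<tau>::real. ereal (1 / \<tau> * (LINT t:{0..\<tau>}|lebesgue. c)) = ereal c) at_top"
    using eventually_gt_at_top[of 0]
    by eventually_elim (simp add: set_lebesgue_integral_def)
  then have "upper_mean (\<lambda>_. c) = Limsup at_top (\<lambda>\<tau>::real. ereal c)"
    unfolding upper_mean_def by (rule Limsup_eq)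
  then show ?thesis by (simp add: Limsup_const)
qed

text \<open>Ensures s \<ge> 0 for a finite upper mean s of the inflow, so that the equilibrium
  s/(\<lambda> + s) lies in [0,1].\<close>

lemma upper_mean_nonneg:
  assumes "AE t in lebesgue. 0 \<le> t \<longrightarrow> 0 \<le> f t"
  shows "0 \<le> upper_mean f"
  unfolding upper_mean_def
proof (rule le_Limsup)
  show "eventually (\<lambda>\<tau>::real. 0 \<le> ereal (1 / \<tau> * (LINT t:{0..\<tau>}|lebesgue. f t))) at_top"
    using eventually_gt_at_top[of 0]
  proof eventually_elim
    case (elim \<tau>)
    have "0 \<le> (LINT t:{0..\<tau>}|lebesgue. f t)"
      unfolding set_lebesgue_integral_def
      by (rule integral_nonneg_AE, use assms in eventually_elim) (auto simp: indicator_def)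
    then show ?case using elim by simp
  qed
qed simp

lemma upper_mean_bottleneck_le_1:
  assumes x: "bottleneck_solution lam \<sigma> x"
  shows "upper_mean x \<le> 1"
  unfolding upper_mean_def
proof (rule Limsup_bounded)
  show "eventually (\<lambda>\<tau>::real. ereal (1 / \<tau> * (LINT t:{0..\<tau>}|lebesgue. x t)) \<le> 1) at_top"
    using eventually_gt_at_top[of 0]
  proof eventually_elim
    case (elim \<tau>)
    note X = set_lebesgue_integral_eq_integral[OF bottleneck_solution_integrable[OF x elim]]
    have "integral {0..\<tau>} x \<le> integral {0..\<tau>} (\<lambda>_. 1)"
      using bottleneck_solution_range[OF x] X(1) by (intro integral_le) auto
    then show ?case using elim by (simp add: X(2) field_simps)
  qed
qed

text \<open>The integral inequality at the equilibrium level c, divided by \<tau>: the additive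
  constant fades and the coefficients recombine to \<lambda>c.\<close>

lemma upper_mean_bottleneck_le_steady_state:
  assumes lam: "0 < lam" and nn: "AE t in lebesgue. 0 \<le> t \<longrightarrow> 0 \<le> \<sigma> t"
    and int: "locally_integrable \<sigma>" and x: "bottleneck_solution lam \<sigma> x"
    and s: "upper_mean \<sigma> = ereal s" "0 \<le> s"
  shows "upper_mean x \<le> ereal (s / (lam + s))"
  unfolding upper_mean_def[of x] Limsup_le_iff
proof (intro allI impI)
  define c where "c = s / (lam + s)"
  have c: "0 \<le> c" "c \<le> 1" using lam s(2) by (auto simp: c_def field_simps)
  \<comment> \<open>At equilibrium, inflow (1 - c)s equals outflow \<lambda>c; geometrically, the
    tangent line meets the curve at s.\<close>
  have balance: "(1 - c)\<^sup>2 * s + lam * c\<^sup>2 = lam * c"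
  proof -
    have "(1 - c) * s = lam * c" using lam s(2) by (simp add: c_def field_simps)
    then have "(1 - c)\<^sup>2 * s = (1 - c) * (lam * c)" by (simp add: power2_eq_square)
    then show ?thesis by (simp add: algebra_simps power2_eq_square)
  qed
  fix C assume "ereal (s / (lam + s)) < C"
  then obtain r where r: "c < r" "ereal r < C" using ereal_dense2 by (force simp: c_def)
  \<comment> \<open>Two errors of at most \<open>e * \<tau>\<close> must fit into
    \<open>lam * (r - c) * \<tau>\<close>: one from the mean inflow exceeding s by up to
    \<open>e\<close>, with weight \<open>(1 - c)\<^sup>2 \<le> 1\<close>, the other from the
    constant 3.\<close>
  define e where "e = lam * (r - c) / 2"
  have "e > 0" using lam r(1) by (simp add: e_def)
  then have "upper_mean \<sigma> < ereal (s + e)" by (simp add: s(1))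
  then have "eventually (\<lambda>\<tau>::real. ereal (1 / \<tau> * (LINT t:{0..\<tau>}|lebesgue. \<sigma> t)) < ereal (s + e)) at_top"
    by (auto simp: upper_mean_def dest!: Limsup_lessD)
  moreover have "eventually (\<lambda>\<tau>::real. \<tau> > max 1 (3 / e)) at_top"
    by (rule eventually_gt_at_top)
  ultimately show "eventually (\<lambda>\<tau>::real. ereal (1 / \<tau> * (LINT t:{0..\<tau>}|lebesgue. x t)) < C) at_top"
  proof eventually_elim
    case (elim \<tau>)
    then have \<tau>: "0 < \<tau>" "3 < e * \<tau>" using \<open>e > 0\<close> by (auto simp: field_simps)
    let ?X = "LINT t:{0..\<tau>}|lebesgue. x t" and ?S = "LINT t:{0..\<tau>}|lebesgue. \<sigma> t"
    have "lam * ?X \<le> (1 - c)\<^sup>2 * ?S + lam * c\<^sup>2 * \<tau> + 3"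
      by (rule bottleneck_integral_bound[OF lam nn int x c \<tau>(1)])
    also have "\<dots> \<le> (1 - c)\<^sup>2 * ((s + e) * \<tau>) + lam * c\<^sup>2 * \<tau> + 3"
      using elim(1) \<tau>(1) by (intro add_right_mono mult_left_mono) (auto simp: field_simps)
    also have "\<dots> = ((1 - c)\<^sup>2 * s + lam * c\<^sup>2) * \<tau> + (1 - c)\<^sup>2 * (e * \<tau>) + 3"
      by (simp add: algebra_simps)
    also have "\<dots> < lam * c * \<tau> + 1 * (e * \<tau>) + e * \<tau>"
      unfolding balance using c \<tau> \<open>e > 0\<close>
      by (intro add_le_less_mono add_left_mono mult_right_mono) (auto simp: power_le_one)
    also have "\<dots> = lam * (r * \<tau>)" by (simp add: e_def algebra_simps)
    finally have "?X < r * \<tau>" using lam by simp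
    then have "ereal (1 / \<tau> * ?X) < ereal r" using \<tau>(1) by (simp add: field_simps)
    then show ?case using r(2) by (rule less_trans)
  qed
qed

text \<open>The equilibrium balances inflow and outflow. All its increments vanish, so any \<delta>,
  here 1, witnesses absolute continuity.\<close>

lemma bottleneck_solution_const:
  assumes "0 < lam" "0 \<le> s"
  shows "bottleneck_solution lam (\<lambda>_. s) (\<lambda>_. s / (lam + s))"
proof -
  have "s * (1 - s / (lam + s)) - lam * (s / (lam + s)) = 0"
    using assms by (simp add: field_simps)
  then show ?thesis
    using assms by (auto simp: bottleneck_solution_def abs_cont_on_def intro: exI[of _ 1])
qed

text \<open>The first conjunct frees \<open>mean_output\<close> from the choice operator. An
  infinite upper mean is a separate case because constant inflows are real; its bound \<lambda> is
  the limit of \<lambda>s/(\<lambda> + s) as s grows, and follows from x \<le> 1.\<close>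

theorem theorem2:
  fixes lam :: real and \<sigma> x :: "real \<Rightarrow> real"
  assumes "0 < lam"
    and "AE t in lebesgue. 0 \<le> t \<longrightarrow> 0 \<le> \<sigma> t"
    and "locally_integrable \<sigma>"
    and "bottleneck_solution lam \<sigma> x"
  shows "mean_output lam \<sigma> = ereal lam * upper_mean x \<and>
    (\<forall>s::real. upper_mean \<sigma> = ereal s \<longrightarrow>
       mean_output lam \<sigma> \<le> mean_output lam (\<lambda>_. s) \<and>
       mean_output lam (\<lambda>_. s) = ereal (lam * s / (lam + s))) \<and>
    (upper_mean \<sigma> = \<infinity> \<longrightarrow> mean_output lam \<sigma> \<le> ereal lam)"
proof (intro conjI allI impI)
  show out: "mean_output lam \<sigma> = ereal lam * upper_mean x"
    using assms by (intro mean_output_eq) auto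
  show "mean_output lam \<sigma> \<le> ereal lam"
    using ereal_mult_left_mono[OF upper_mean_bottleneck_le_1[OF assms(4)], of "ereal lam"] assms(1)
    by (simp add: out)
  fix s assume s: "upper_mean \<sigma> = ereal s"
  then have "0 \<le> s" using upper_mean_nonneg[OF assms(2)] by simp
  show const: "mean_output lam (\<lambda>_. s) = ereal (lam * s / (lam + s))"
    using mean_output_eq[OF assms(1) _ bottleneck_solution_const[OF assms(1) \<open>0 \<le> s\<close>]] \<open>0 \<le> s\<close>
    by (simp add: upper_mean_const)
  show "mean_output lam \<sigma> \<le> mean_output lam (\<lambda>_. s)"
    using ereal_mult_left_mono[OF upper_mean_bottleneck_le_steady_state[OF assms s \<open>0 \<le> s\<close>], of "ereal lam"]
      assms(1)
    by (simp add: out const)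
qed

end
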